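(* Let $G$ be a finite simple undirected graph with $n$ vertices that has a vertex cover of size $k$. Then $G$ has at most $4^k + n$ potential maximal cliques.
   Context: A vertex cover of $G$ is a set $V_k\subseteq V(G)$ such that every edge of $G$ has at least one endpoint in $V_k$. A triangulation of $G$ is a chordal graph $H$ with $V(H)=V(G)$ and $E(G)\subseteq E(H)$; it is minimal if no triangulation of $G$ has an edge set that is a proper subset of $E(H)$. A set $\Omega\subseteq V(G)$ is a potential maximal clique (PMC) of $G$ if $\Omega$ is a maximal clique of some minimal triangulation of $G$. *)

theory Defs
  imports Main "HOL-Library.Ramsey"
begin

text \<open>A graph is given by a vertex set \<open>V\<close> and a set \<open>E\<close> of two-element subsets of \<open>V\<close>.
  \<open>Ramsey.clique K E\<close> says that any two distinct elements of \<open>K\<close> are joined by an edge in \<open>E\<close>.\<close>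

definition finite_simple_graph :: "'a set \<Rightarrow> 'a set set \<Rightarrow> bool" where
  "finite_simple_graph V E \<longleftrightarrow> finite V \<and> E \<subseteq> [V]\<^bsup>2\<^esup>"

definition vertex_cover :: "'a set \<Rightarrow> 'a set set \<Rightarrow> 'a set \<Rightarrow> bool" where
  "vertex_cover V E S \<longleftrightarrow> S \<subseteq> V \<and> (\<forall>e\<in>E. e \<inter> S \<noteq> {})"

text \<open>A cycle is represented by the list of its vertices; the last one is adjacent to the first.\<close>

definition cycle_edges :: "'a list \<Rightarrow> 'a set set" where
  "cycle_edges c = {{c ! i, c ! (Suc i mod length c)} | i. i < length c}"

definition is_cycle :: "'a set \<Rightarrow> 'a set set \<Rightarrow> 'a list \<Rightarrow> bool" where
  "is_cycle V E c \<longleftrightarrow> 3 \<le> length c \<and> distinct c \<and> set c \<subseteq> V \<and> cycle_edges c \<subseteq> E"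

definition is_chord :: "'a set set \<Rightarrow> 'a list \<Rightarrow> 'a set \<Rightarrow> bool" where
  "is_chord E c e \<longleftrightarrow> e \<in> E \<and> e \<subseteq> set c \<and> e \<notin> cycle_edges c"

definition chordal :: "'a set \<Rightarrow> 'a set set \<Rightarrow> bool" where
  "chordal V E \<longleftrightarrow> finite_simple_graph V E \<and>
     (\<forall>c. is_cycle V E c \<and> 4 \<le> length c \<longrightarrow> (\<exists>e. is_chord E c e))"

text \<open>A triangulation has the same vertex set as the graph, so only its edge set \<open>F\<close> is passed.\<close>

definition triangulation :: "'a set \<Rightarrow> 'a set set \<Rightarrow> 'a set set \<Rightarrow> bool" where
  "triangulation V E F \<longleftrightarrow> chordal V F \<and> E \<subseteq> F"

definition minimal_triangulation :: "'a set \<Rightarrow> 'a set set \<Rightarrow> 'a set set \<Rightarrow> bool" where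
  "minimal_triangulation V E F \<longleftrightarrow>
     triangulation V E F \<and> \<not> (\<exists>F'. triangulation V E F' \<and> F' \<subset> F)"

definition maximal_clique :: "'a set \<Rightarrow> 'a set set \<Rightarrow> 'a set \<Rightarrow> bool" where
  "maximal_clique V E K \<longleftrightarrow>
     K \<subseteq> V \<and> clique K E \<and> \<not> (\<exists>K'. K' \<subseteq> V \<and> clique K' E \<and> K \<subset> K')"

definition potential_maximal_clique :: "'a set \<Rightarrow> 'a set set \<Rightarrow> 'a set \<Rightarrow> bool" where
  "potential_maximal_clique V E \<Omega> \<longleftrightarrow>
     (\<exists>F. minimal_triangulation V E F \<and> maximal_clique V F \<Omega>)"

text \<open>The cardinality of the set of potential maximal cliques is therefore a genuine count.\<close>

lemma finite_potential_maximal_cliques: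
  assumes "finite V"
  shows "finite {\<Omega>. potential_maximal_clique V E \<Omega>}"
proof (rule finite_subset)
  show "{\<Omega>. potential_maximal_clique V E \<Omega>} \<subseteq> Pow V"
    by (auto simp: potential_maximal_clique_def maximal_clique_def)
qed (use assms in simp)

end

theory Submission
  imports Defs
begin

text \<open>
  Two properties of a potential maximal clique \<open>\<Omega>\<close> are used: nonadjacent vertices of \<open>\<Omega>\<close> have
  neighbours in a common component of \<open>G - \<Omega>\<close>, and no component \<open>C\<close> has \<open>N(C) = \<Omega>\<close>.  Let \<open>S\<close> be
  the vertex cover; a vertex outside both \<open>S\<close> and \<open>\<Omega>\<close> sees at most one component.

  If some \<open>x \<in> \<Omega> - S\<close> sees no component, then \<open>\<Omega> = N[x]\<close>, which gives at most \<open>n\<close> sets.  If every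
  \<open>x \<in> \<Omega> - S\<close> sees at least two components, the sets of seen components form an intersecting
  family without singletons, so the components can be 3-coloured with no set monochromatic; the
  colouring of \<open>S - \<Omega>\<close> determines \<open>\<Omega>\<close>, and fixing the colour of one vertex by symmetry leaves
  \<open>2 * 4 ^ (k - 1)\<close> codes.  Otherwise some \<open>x\<close> sees a single component \<open>C\<close>; then every vertex of
  \<open>\<Omega> - S\<close> sees \<open>C\<close>, and those that see nothing else are adjacent to any \<open>y \<in> \<Omega> - N(C)\<close>.  So \<open>y\<close>
  and the partition of \<open>S - {y}\<close> into \<open>\<Omega>\<close>, \<open>C\<close> and the rest determine \<open>\<Omega>\<close>, giving
  \<open>k * 3 ^ (k - 1) \<le> 2 * 4 ^ (k - 1)\<close> codes.
\<close>

lemma edgeD: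
  assumes "finite_simple_graph V E" "{x, y} \<in> E"
  shows "x \<in> V" "y \<in> V" "x \<noteq> y"
  using assms by (auto simp: finite_simple_graph_def nsets_def)

lemma edge_cases:
  assumes "finite_simple_graph V E" "e \<in> E"
  obtains x y where "e = {x, y}" "x \<noteq> y"
  using assms by (auto simp: finite_simple_graph_def nsets_def card_2_iff)

section \<open>Cycles and walks\<close>

lemma cycle_edges_rotate_subset: "cycle_edges (rotate k c) \<subseteq> cycle_edges c"
proof
  fix e assume "e \<in> cycle_edges (rotate k c)"
  then obtain i where i: "i < length c"
    and e: "e = {rotate k c ! i, rotate k c ! (Suc i mod length c)}"
    by (auto simp: cycle_edges_def)
  let ?j = "(k + i) mod length c"
  have "rotate k c ! i = c ! ?j" using i by (simp add: nth_rotate)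
  moreover have "rotate k c ! (Suc i mod length c) = c ! (Suc ?j mod length c)"
  proof -
    have "Suc i mod length c < length c" using i by (intro mod_less_divisor) linarith
    then have "rotate k c ! (Suc i mod length c) = c ! ((k + Suc i mod length c) mod length c)"
      by (rule nth_rotate)
    then show ?thesis by (simp add: mod_simps)
  qed
  moreover have "?j < length c" using i by (intro mod_less_divisor) linarith
  ultimately show "e \<in> cycle_edges c" using e by (auto simp: cycle_edges_def)
qed

text \<open>A rotation is undone by a further rotation, so the one-sided inclusion suffices. The
  equality allows a cycle to be started at any chosen vertex.\<close>

lemma cycle_edges_rotate: "cycle_edges (rotate k c) = cycle_edges c"
proof
  show "cycle_edges (rotate k c) \<subseteq> cycle_edges c" by (rule cycle_edges_rotate_subset)
  obtain l where "rotate l (rotate k c) = c"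
  proof
    show "rotate (length c - k mod length c) (rotate k c) = c"
    proof (cases "c = []")
      case False
      have "rotate (length c - k mod length c) (rotate (k mod length c) c) = rotate (length c) c"
        using False by (simp add: rotate_rotate less_imp_le)
      then show ?thesis by (simp flip: rotate_conv_mod)
    qed simp
  qed
  then show "cycle_edges c \<subseteq> cycle_edges (rotate k c)"
    by (metis cycle_edges_rotate_subset)
qed

text \<open>The last two hypotheses rule out a step of the cycle and its closing edge, the only ways
  in which two positions can be consecutive.\<close>

lemma not_cycle_edge:
  assumes "distinct c" "i < j" "j < length c" "j \<noteq> Suc i" "i \<noteq> 0 \<or> Suc j \<noteq> length c"
  shows "{c ! i, c ! j} \<notin> cycle_edges c"
proof
  assume "{c ! i, c ! j} \<in> cycle_edges c"
  then obtain l where l: "l < length c" and eq: "{c ! i, c ! j} = {c ! l, c ! (Suc l mod length c)}"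
    by (auto simp: cycle_edges_def)
  have "Suc l mod length c < length c" using l by (intro mod_less_divisor) linarith
  then have "(i = l \<and> j = Suc l mod length c) \<or> (j = l \<and> i = Suc l mod length c)"
    using eq l assms by (auto simp: doubleton_eq_iff nth_eq_iff_index_eq)
  then show False using assms l by (cases "Suc l = length c") auto
qed

text \<open>Serves to shorten walks: the new walk is strictly shorter unless
  \<open>j = Suc i\<close>, so a shortest walk has no edge between nonconsecutive positions.\<close>

lemma shortcut_walk:
  assumes w: "successively R q" and ij: "i < j" "j < length q" and R: "R (q ! i) (q ! j)"
  defines "q' \<equiv> take (Suc i) q @ drop j q"
  shows "successively R q'" "hd q' = hd q" "last q' = last q" "set q' \<subseteq> set q"
    "length q' = Suc i + (length q - j)"
proof -
  have "successively R (take (Suc i) q @ drop (Suc i) q)" using w by simp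
  then have 1: "successively R (take (Suc i) q)"
    unfolding successively_append_iff by blast
  have "successively R (take j q @ drop j q)" using w by simp
  then have 2: "successively R (drop j q)" unfolding successively_append_iff by blast
  have "last (take (Suc i) q) = q ! i" using ij by (simp add: take_Suc_conv_app_nth)
  moreover have "hd (drop j q) = q ! j" using ij by (simp add: hd_drop_conv_nth)
  ultimately show "successively R q'"
    using 1 2 R ij by (simp add: q'_def successively_append_iff)
  show "hd q' = hd q" using ij by (cases q) (auto simp: q'_def)
  show "last q' = last q" using ij by (simp add: q'_def)
  show "set q' \<subseteq> set q" using set_take_subset set_drop_subset by (fastforce simp: q'_def)
  show "length q' = Suc i + (length q - j)" using ij by (simp add: q'_def)
qed

text \<open>Cutting out the closed part between two visits of a vertex always shortens the walk, so
  a shortest walk is \<open>distinct\<close>.\<close>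

lemma shortcut_walk_eq:
  assumes w: "successively R q" and ij: "i < j" "j < length q" and eq: "q ! i = q ! j"
  defines "q' \<equiv> take (Suc i) q @ drop (Suc j) q"
  shows "successively R q'" "hd q' = hd q" "last q' = last q" "set q' \<subseteq> set q"
    "length q' = Suc i + (length q - Suc j)"
proof -
  have lt: "last (take (Suc i) q) = q ! i" using ij by (simp add: take_Suc_conv_app_nth)
  have "successively R (take (Suc i) q @ drop (Suc i) q)" using w by simp
  then have 1: "successively R (take (Suc i) q)"
    unfolding successively_append_iff by blast
  have "successively R (take (Suc j) q @ drop (Suc j) q)" using w by simp
  then have 2: "successively R (drop (Suc j) q)"
    and 3: "drop (Suc j) q \<noteq> [] \<Longrightarrow> R (q ! j) (hd (drop (Suc j) q))"
    unfolding successively_append_iff using ij by (auto simp: take_Suc_conv_app_nth)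
  show "successively R q'"
    using 1 2 3 eq lt by (auto simp: q'_def successively_append_iff)
  show "hd q' = hd q" using ij by (cases q) (auto simp: q'_def)
  show "last q' = last q"
  proof (cases "Suc j = length q")
    case True
    then have "q' = take (Suc i) q" by (simp add: q'_def)
    moreover have "last q = q ! j" using True last_conv_nth[of q] ij by (metis diff_Suc_1 length_0_conv not_less_zero)
    ultimately show ?thesis using lt eq by simp
  qed (use ij in \<open>simp add: q'_def\<close>)
  show "set q' \<subseteq> set q" using set_take_subset set_drop_subset by (fastforce simp: q'_def)
  show "length q' = Suc i + (length q - Suc j)" using ij by (simp add: q'_def)
qed

text \<open>A shortest such walk \<open>q\<close> is an induced path. If \<open>a\<close> and
  \<open>b\<close> were nonadjacent, \<open>u # q\<close> would be a cycle of length at least 4. Its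
  chord could not meet \<open>u\<close>, as \<open>W\<close> contains no neighbour of
  \<open>u\<close>, nor join two vertices of \<open>q\<close>.\<close>

lemma chordal_neighbours_joined_by_far_walk_adjacent:
  assumes ch: "chordal V F" and ua: "{u, a} \<in> F" and ub: "{u, b} \<in> F" and "a \<noteq> b"
    and W: "u \<notin> W" "\<And>z. z \<in> W \<Longrightarrow> {u, z} \<notin> F"
    and q0: "successively (\<lambda>s t. {s, t} \<in> F) q0" "q0 \<noteq> []" "hd q0 = a" "last q0 = b"
      "set q0 \<subseteq> {a, b} \<union> W"
  shows "{a, b} \<in> F"
proof (rule ccontr)
  assume nab: "{a, b} \<notin> F"
  have fg: "finite_simple_graph V F" using ch by (simp add: chordal_def)
  let ?P = "\<lambda>q. successively (\<lambda>s t. {s, t} \<in> F) q \<and> q \<noteq> [] \<and> hd q = a \<and> last q = b \<and>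
    set q \<subseteq> {a, b} \<union> W"
  obtain q where q: "?P q" and min: "\<And>q'. ?P q' \<Longrightarrow> length q \<le> length q'"
    using ex_has_least_nat[of ?P q0 length] q0 by blast
  have ind: "j = Suc i" if "i < j" "j < length q" "{q ! i, q ! j} \<in> F" for i j
  proof (rule ccontr)
    assume "j \<noteq> Suc i"
    have "?P (take (Suc i) q @ drop j q)"
      using shortcut_walk[of "\<lambda>s t. {s, t} \<in> F" q i j] that q by auto
    from min[OF this] show False using that \<open>j \<noteq> Suc i\<close> by simp
  qed
  have dist: "distinct q"
  proof (rule ccontr)
    assume "\<not> distinct q"
    then obtain i j where ij: "i < j" "j < length q" "q ! i = q ! j"
      by (metis distinct_conv_nth nat_neq_iff)
    have "?P (take (Suc i) q @ drop (Suc j) q)"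
      using shortcut_walk_eq[of "\<lambda>s t. {s, t} \<in> F" q i j] ij q by auto
    from min[OF this] show False using ij by simp
  qed
  have q_first: "q ! 0 = a" and q_last: "q ! (length q - 1) = b"
    using q by (auto simp: hd_conv_nth last_conv_nth)
  have steps: "{q ! i, q ! Suc i} \<in> F" if "Suc i < length q" for i
    using q that by (auto simp: successively_conv_nth)
  have "length q \<noteq> 0" using q by simp
  moreover have "length q \<noteq> 1" using q_first q_last \<open>a \<noteq> b\<close> by auto
  moreover have "length q \<noteq> 2" using q_first q_last nab steps[of 0] by auto
  ultimately have len: "3 \<le> length q" by linarith
  let ?c = "u # q"
  have uq: "u \<notin> set q"
    using q W edgeD[OF fg ua] edgeD[OF fg ub] by auto
  have "set q \<subseteq> V"
  proof
    fix z assume "z \<in> set q"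
    then obtain i where i: "i < length q" "z = q ! i" by (auto simp: in_set_conv_nth)
    show "z \<in> V"
    proof (cases "Suc i < length q")
      case True
      then show ?thesis using edgeD[OF fg steps[of i]] i by simp
    next
      case False
      then have "i = length q - 1" using i by simp
      then show ?thesis using i q_last edgeD[OF fg ub] by simp
    qed
  qed
  moreover have "cycle_edges ?c \<subseteq> F"
  proof
    fix e assume "e \<in> cycle_edges ?c"
    then obtain i where i: "i < Suc (length q)" "e = {?c ! i, ?c ! (Suc i mod Suc (length q))}"
      by (auto simp: cycle_edges_def)
    consider "i = 0" | l where "i = Suc l" "Suc l < length q" | "i = length q"
      using i(1) by (cases i) (auto, linarith)
    then show "e \<in> F"
    proof cases
      case 1
      moreover have "q \<noteq> []" using len by auto
      ultimately show ?thesis using i ua q_first by simp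
    next
      case 2
      then show ?thesis using i steps by simp
    next
      case 3
      moreover have "q \<noteq> []" using len by auto
      ultimately have "e = {b, u}" using i q_last by (simp add: nth_Cons')
      then show ?thesis using ub by (simp add: insert_commute)
    qed
  qed
  ultimately have "is_cycle V F ?c"
    using dist uq len edgeD[OF fg ua] by (simp add: is_cycle_def)
  then obtain e where e: "e \<in> F" "e \<subseteq> set ?c" "e \<notin> cycle_edges ?c"
    using ch len unfolding chordal_def is_chord_def by fastforce
  have "q \<noteq> []" using q by simp
  have ce: "{u, a} \<in> cycle_edges ?c" "{u, b} \<in> cycle_edges ?c"
  proof -
    have "{?c ! 0, ?c ! (Suc 0 mod length ?c)} \<in> cycle_edges ?c"
      unfolding cycle_edges_def by fastforce
    then show "{u, a} \<in> cycle_edges ?c" using q_first \<open>q \<noteq> []\<close> by simp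
    have "{?c ! length q, ?c ! (Suc (length q) mod length ?c)} \<in> cycle_edges ?c"
      unfolding cycle_edges_def by fastforce
    then show "{u, b} \<in> cycle_edges ?c" using q_last \<open>q \<noteq> []\<close> by (simp add: nth_Cons' insert_commute)
  qed
  have *: False if "e = {u, z}" "z \<noteq> u" for z
  proof -
    have "z \<in> set q" using that e by auto
    then have "z = a \<or> z = b" using that e W q by auto
    then show False using ce e that by auto
  qed
  obtain s t where st: "e = {s, t}" "s \<noteq> t" using edge_cases[OF fg e(1)] .
  have "s \<noteq> u" "t \<noteq> u" using *[of t] *[of s] st by (auto simp: insert_commute)
  then have "s \<in> set q" "t \<in> set q" using e st by auto
  then obtain i' j' where ij': "i' < length q" "j' < length q" "s = q ! i'" "t = q ! j'"
    by (auto simp: in_set_conv_nth)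
  obtain i j where ij: "i < j" "j < length q" "e = {q ! i, q ! j}"
  proof (cases "i' < j'")
    case True
    then show thesis using that[of i' j'] ij' st by simp
  next
    case False
    then have "j' < i'" using ij' st(2) by (metis nat_neq_iff)
    moreover have "e = {q ! j', q ! i'}" using ij' st by auto
    ultimately show thesis using that[of j' i'] ij' by simp
  qed
  then have j: "j = Suc i" using ind e by auto
  have "{?c ! Suc i, ?c ! (Suc (Suc i) mod length ?c)} \<in> cycle_edges ?c"
    unfolding cycle_edges_def using ij by fastforce
  then show False using e ij j by simp
qed

section \<open>Components of the complement of a potential maximal clique\<close>

text \<open>For \<open>a\<close> outside \<Omega> this is the connected component of
  \<open>a\<close> in G - \<Omega>; for \<open>a\<close> in \<Omega> it degenerates to
  \<open>{a}\<close>.\<close>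

definition component :: "'a set set \<Rightarrow> 'a set \<Rightarrow> 'a \<Rightarrow> 'a set" where
  "component E \<Omega> a = {b. (a, b) \<in> {(s, t). {s, t} \<in> E \<and> s \<notin> \<Omega> \<and> t \<notin> \<Omega>}\<^sup>*}"

text \<open>This is the open neighbourhood N(C) when \<open>C\<close> is a component of G -
  \<Omega>, since every neighbour of \<open>C\<close> outside \<open>C\<close> then lies in
  \<Omega>.\<close>

definition boundary :: "'a set set \<Rightarrow> 'a set \<Rightarrow> 'a set \<Rightarrow> 'a set" where
  "boundary E \<Omega> C = {w \<in> \<Omega>. \<exists>c\<in>C. {c, w} \<in> E}"

lemma boundaryE:
  assumes "w \<in> boundary E \<Omega> C"
  obtains c where "c \<in> C" "{w, c} \<in> E"
proof -
  obtain c where "c \<in> C" "{c, w} \<in> E" using assms by (auto simp: boundary_def)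
  moreover have "{c, w} = {w, c}" by (rule insert_commute)
  ultimately show ?thesis using that by simp
qed

lemma self_in_component [simp]: "a \<in> component E \<Omega> a"
  by (simp add: component_def)

lemma component_disjoint: "a \<notin> \<Omega> \<Longrightarrow> component E \<Omega> a \<inter> \<Omega> = {}"
  by (auto simp: component_def elim: rtranclE)

lemma component_eq:
  assumes "b \<in> component E \<Omega> a" shows "component E \<Omega> b = component E \<Omega> a"
proof -
  let ?R = "{(s, t). {s, t} \<in> E \<and> s \<notin> \<Omega> \<and> t \<notin> \<Omega>}"
  have "sym (?R\<^sup>*)" by (rule sym_rtrancl) (auto simp: sym_def insert_commute)
  moreover have "(a, b) \<in> ?R\<^sup>*" using assms by (simp add: component_def)
  ultimately have "(b, a) \<in> ?R\<^sup>*" by (meson symD)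
  then show ?thesis
    using \<open>(a, b) \<in> ?R\<^sup>*\<close> by (auto simp: component_def intro: rtrancl_trans)
qed

lemma component_adjacent:
  assumes "{a, b} \<in> E" "a \<notin> \<Omega>" "b \<notin> \<Omega>"
  shows "component E \<Omega> a = component E \<Omega> b"
proof -
  have "b \<in> component E \<Omega> a" using assms by (auto simp: component_def)
  then show ?thesis using component_eq by fastforce
qed

lemma component_subset:
  assumes "finite_simple_graph V E" "a \<in> V"
  shows "component E \<Omega> a \<subseteq> V"
proof
  fix b assume "b \<in> component E \<Omega> a"
  then show "b \<in> V"
    using assms by (auto simp: component_def elim: rtranclE dest: edgeD)
qed

lemma component_walk:
  assumes "b \<in> component E \<Omega> a"
  obtains q where "successively (\<lambda>s t. {s, t} \<in> E) q" "q \<noteq> []" "hd q = a" "last q = b"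
    "set q \<subseteq> component E \<Omega> a"
proof -
  have "(a, b) \<in> {(s, t). {s, t} \<in> E \<and> s \<notin> \<Omega> \<and> t \<notin> \<Omega>}\<^sup>*"
    using assms by (simp add: component_def)
  then have "\<exists>q. successively (\<lambda>s t. {s, t} \<in> E) q \<and> q \<noteq> [] \<and> hd q = a \<and> last q = b \<and>
      set q \<subseteq> component E \<Omega> a"
  proof (induction rule: rtrancl_induct)
    case base
    show ?case by (rule exI[of _ "[a]"]) simp
  next
    case (step y z)
    then obtain q where q: "successively (\<lambda>s t. {s, t} \<in> E) q" "q \<noteq> []" "hd q = a" "last q = y"
      "set q \<subseteq> component E \<Omega> a" by auto
    have "z \<in> component E \<Omega> a"
      using step by (auto simp: component_def intro: rtrancl_into_rtrancl)
    then show ?case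
      using q step by (intro exI[of _ "q @ [z]"]) (auto simp: successively_append_iff)
  qed
  then show ?thesis using that by blast
qed

text \<open>A vertex of the component with the most neighbours in \<open>\<Omega>\<close> is adjacent to all of \<open>\<Omega>\<close>:
  otherwise walk from it to the first neighbour \<open>z\<close> of a missing vertex \<open>w\<close>; chordality makes
  \<open>z\<close> adjacent to all old neighbours in \<open>\<Omega>\<close> as well as to \<open>w\<close>.\<close>

lemma component_not_full:
  assumes G: "finite_simple_graph V E" and T: "triangulation V E F"
    and M: "maximal_clique V F \<Omega>" and a: "a \<in> V - \<Omega>"
  shows "\<exists>w\<in>\<Omega>. w \<notin> boundary E \<Omega> (component E \<Omega> a)"
proof (rule ccontr)
  assume "\<not> ?thesis"
  then have full: "\<Omega> \<subseteq> boundary E \<Omega> (component E \<Omega> a)" by blast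
  have ch: "chordal V F" and EF: "E \<subseteq> F" using T by (auto simp: triangulation_def)
  have \<Omega>: "\<Omega> \<subseteq> V" "clique \<Omega> F" using M by (auto simp: maximal_clique_def)
  have fin: "finite \<Omega>" using G \<Omega> by (auto simp: finite_simple_graph_def intro: finite_subset)
  let ?C = "component E \<Omega> a"
  let ?N = "\<lambda>c. {u \<in> \<Omega>. {u, c} \<in> F}"
  have CV: "?C \<subseteq> V" using component_subset G a by fastforce
  have C\<Omega>: "?C \<inter> \<Omega> = {}" using a by (intro component_disjoint) simp
  have "finite ?C" using CV G by (auto simp: finite_simple_graph_def intro: finite_subset)
  then obtain c where c: "c \<in> ?C" and cmax: "\<And>d. d \<in> ?C \<Longrightarrow> card (?N d) \<le> card (?N c)"
    using Max_in[of "(card \<circ> ?N) ` ?C"] Max_ge[of "(card \<circ> ?N) ` ?C"] self_in_component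
    by (smt (verit, ccfv_threshold) comp_apply empty_iff finite_imageI imageE image_eqI image_is_empty)
  have "\<not> clique (insert c \<Omega>) F"
    using M c CV C\<Omega> \<Omega> unfolding maximal_clique_def by blast
  then obtain w where w: "w \<in> \<Omega>" "{w, c} \<notin> F"
    using \<Omega> by (auto simp: clique_def insert_commute)
  obtain d where d: "d \<in> ?C" "{w, d} \<in> F"
    using boundaryE[OF subsetD[OF full w(1)]] EF by blast
  have "d \<in> component E \<Omega> c" using component_eq[OF c] d by simp
  then obtain q where q: "successively (\<lambda>s t. {s, t} \<in> E) q" "q \<noteq> []" "hd q = c" "last q = d"
    "set q \<subseteq> ?C"
    using component_walk[of d E \<Omega> c] component_eq[OF c] by metis
  have "\<exists>z\<in>set q. {w, z} \<in> F" using d q by auto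
  then obtain q1 z q2 where z: "q = q1 @ z # q2" "{w, z} \<in> F" "\<forall>y\<in>set q1. {w, y} \<notin> F"
    using split_list_first_prop[of q "\<lambda>z. {w, z} \<in> F"] by blast
  have "q1 \<noteq> []" using z q w by auto
  then have hd1: "hd q1 = c" using z q by simp
  have zC: "z \<in> ?C" using z q by auto
  have "?N c \<subseteq> ?N z"
  proof
    fix u assume u: "u \<in> ?N c"
    have "{u, z} \<in> F"
    proof (rule ccontr)
      \<comment> \<open>Let \<open>y\<close> be the last neighbour of \<open>u\<close> before
        \<open>z\<close>. The walk from \<open>y\<close> through \<open>z\<close> to
        \<open>w\<close> has no inner neighbour of \<open>u\<close>, while \<open>y\<close> and
        \<open>w\<close> are both adjacent to \<open>u\<close>. Hence \<open>y\<close> is adjacent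
        to \<open>w\<close>, although \<open>z\<close> was the first neighbour of
        \<open>w\<close>.\<close>
      assume nz: "{u, z} \<notin> F"
      have "c \<in> set q1" using hd1 \<open>q1 \<noteq> []\<close> by auto
      then have "\<exists>y\<in>set q1. {u, y} \<in> F" using u by auto
      then obtain r1 y r2 where y: "q1 = r1 @ y # r2" "{u, y} \<in> F" "\<forall>t\<in>set r2. {u, t} \<notin> F"
        using split_list_last_prop[of q1 "\<lambda>y. {u, y} \<in> F"] by blast
      let ?q = "y # r2 @ [z, w]"
      have "successively (\<lambda>s t. {s, t} \<in> E) (y # r2 @ [z])"
      proof -
        have "q = r1 @ (y # r2 @ [z]) @ q2" using z y by simp
        then show ?thesis using q(1) by (metis successively_append_iff)
      qed
      then have "successively (\<lambda>s t. {s, t} \<in> F) (y # r2 @ [z])"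
        by (rule successively_mono) (use EF in auto)
      then have "successively (\<lambda>s t. {s, t} \<in> F) ((y # r2 @ [z]) @ [w])"
        using z(2) unfolding successively_append_iff by (simp add: insert_commute)
      then have succ: "successively (\<lambda>s t. {s, t} \<in> F) ?q" by simp
      have "u \<noteq> w" using u w by auto
      then have uw: "{u, w} \<in> F" using u w \<Omega> by (auto simp: clique_def)
      have u\<Omega>: "u \<in> \<Omega>" using u by simp
      have sub: "set r2 \<union> {z, y} \<subseteq> ?C" using q z y by auto
      have "{y, w} \<in> F"
      proof (rule chordal_neighbours_joined_by_far_walk_adjacent[OF ch y(2) uw])
        show "y \<noteq> w" using sub C\<Omega> w by auto
        show "u \<notin> set r2 \<union> {z}" using sub C\<Omega> u\<Omega> by auto
        show "\<And>t. t \<in> set r2 \<union> {z} \<Longrightarrow> {u, t} \<notin> F" using y nz by auto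
        show "successively (\<lambda>s t. {s, t} \<in> F) ?q" by (rule succ)
      qed auto
      then show False using z y by (auto simp: insert_commute)
    qed
    then show "u \<in> ?N z" using u by simp
  qed
  moreover have "w \<in> ?N z" "w \<notin> ?N c" using w z by auto
  ultimately have "?N c \<subset> ?N z" by blast
  then have "card (?N c) < card (?N z)" using fin by (simp add: psubset_card_mono)
  then show False using cmax[OF zC] by simp
qed

text \<open>If no component sees both \<open>x\<close> and \<open>y\<close>, then deleting \<open>{x, y}\<close> from \<open>F\<close>, together with
  all edges that join a component to a vertex outside its closed neighbourhood in \<open>E\<close>, leaves a
  smaller triangulation.\<close>

lemma nonadjacent_share_component:
  assumes G: "finite_simple_graph V E" and T: "minimal_triangulation V E F"
    and M: "maximal_clique V F \<Omega>" and x: "x \<in> \<Omega>" and y: "y \<in> \<Omega>" and "x \<noteq> y"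
    and xy: "{x, y} \<notin> E"
  shows "\<exists>a\<in>V - \<Omega>. {x, y} \<subseteq> boundary E \<Omega> (component E \<Omega> a)"
proof (rule ccontr)
  assume no: "\<not> ?thesis"
  have ch: "chordal V F" and EF: "E \<subseteq> F"
    using T by (auto simp: minimal_triangulation_def triangulation_def)
  then have fg: "finite_simple_graph V F" by (simp add: chordal_def)
  have \<Omega>: "\<Omega> \<subseteq> V" "clique \<Omega> F" using M by (auto simp: maximal_clique_def)
  let ?C = "component E \<Omega>"
  let ?B = "\<lambda>a. boundary E \<Omega> (?C a)"
  define F' where "F' = {e \<in> F. e \<noteq> {x, y} \<and> (e \<subseteq> \<Omega> \<or> (\<exists>a\<in>V - \<Omega>. e \<subseteq> ?C a \<union> ?B a))}"
  have F'F: "F' \<subseteq> F" by (auto simp: F'_def)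
  have xyF: "{x, y} \<in> F" using x y \<Omega> \<open>x \<noteq> y\<close> by (auto simp: clique_def)
  then have strict: "F' \<subset> F" using F'F by (auto simp: F'_def)
  have EF': "E \<subseteq> F'"
  proof
    fix e assume e: "e \<in> E"
    obtain s t where st: "e = {s, t}" using edge_cases[OF G e] .
    have stV: "s \<in> V" "t \<in> V" using edgeD[OF G] e st by auto
    have half: "\<exists>a\<in>V - \<Omega>. {s, t} \<subseteq> ?C a \<union> ?B a" if "s \<notin> \<Omega>" "s \<in> V" "{s, t} \<in> E" for s t
    proof (cases "t \<in> \<Omega>")
      case True
      then have "t \<in> ?B s" using that by (auto simp: boundary_def intro!: bexI[of _ s])
      then show ?thesis using that by (intro bexI[of _ s]) auto
    next
      case False
      then have "t \<in> ?C s" using that component_adjacent self_in_component by metis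
      then show ?thesis using that by (intro bexI[of _ s]) auto
    qed
    have "e \<subseteq> \<Omega> \<or> (\<exists>a\<in>V - \<Omega>. e \<subseteq> ?C a \<union> ?B a)"
      using half[of s t] half[of t s] st stV e by (auto simp: insert_commute)
    then show "e \<in> F'" using e EF xy by (auto simp: F'_def)
  qed
  \<comment> \<open>As \<open>u\<close> is outside \<Omega>, the edge was kept because of some
    component with its boundary; that component contains \<open>u\<close>, so it is the one of
    \<open>a\<close>.\<close>
  have leave: "v \<in> ?C a \<union> ?B a" if uv: "{u, v} \<in> F'" and "u \<in> ?C a" and "a \<in> V - \<Omega>" for u v a
  proof -
    have "u \<notin> \<Omega>" using component_disjoint that by fastforce
    then obtain b where b: "b \<in> V - \<Omega>" "{u, v} \<subseteq> ?C b \<union> ?B b"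
      using uv unfolding F'_def by blast
    then have "u \<in> ?C b" using \<open>u \<notin> \<Omega>\<close> by (auto simp: boundary_def)
    then have "?C b = ?C a" using that component_eq by metis
    then show ?thesis using b by auto
  qed
  have "chordal V F'"
    unfolding chordal_def
  proof (intro conjI allI impI)
    show "finite_simple_graph V F'" using fg F'F by (auto simp: finite_simple_graph_def)
    fix c0 assume c0: "is_cycle V F' c0 \<and> 4 \<le> length c0"
    show "\<exists>e. is_chord F' c0 e"
    proof (cases "set c0 \<subseteq> \<Omega>")
      case True
      \<comment> \<open>Inside the clique \<Omega> the diagonals 0-2 and 1-3 are both in
        \<open>F\<close>, and at most one of them is the deleted edge \<open>{x, y}\<close>.\<close>
      have d: "distinct c0" using c0 by (simp add: is_cycle_def)
      have l: "0 < length c0" "1 < length c0" "2 < length c0" "3 < length c0" using c0 by auto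
      have in\<Omega>: "c0 ! 0 \<in> \<Omega>" "c0 ! 1 \<in> \<Omega>" "c0 ! 2 \<in> \<Omega>" "c0 ! 3 \<in> \<Omega>"
        using True l nth_mem by blast+
      have ne: "c0 ! 0 \<noteq> c0 ! 1" "c0 ! 0 \<noteq> c0 ! 2" "c0 ! 0 \<noteq> c0 ! 3" "c0 ! 1 \<noteq> c0 ! 3"
        using d l by (auto simp only: nth_eq_iff_index_eq)
      have F: "{c0 ! 0, c0 ! 2} \<in> F" "{c0 ! 1, c0 ! 3} \<in> F"
        using in\<Omega> ne \<Omega> by (auto simp: clique_def)
      have "{c0 ! 0, c0 ! 2} \<noteq> {c0 ! 1, c0 ! 3}" using ne by (auto simp: doubleton_eq_iff)
      then consider "{c0 ! 0, c0 ! 2} \<noteq> {x, y}" | "{c0 ! 1, c0 ! 3} \<noteq> {x, y}" by blast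
      then show ?thesis
      proof cases
        case 1
        have "{c0 ! 0, c0 ! 2} \<notin> cycle_edges c0" using d l by (intro not_cycle_edge) auto
        then have "is_chord F' c0 {c0 ! 0, c0 ! 2}"
          using 1 F in\<Omega> l by (auto simp: is_chord_def F'_def)
        then show ?thesis by blast
      next
        case 2
        have "{c0 ! 1, c0 ! 3} \<notin> cycle_edges c0" using d l by (intro not_cycle_edge) auto
        then have "is_chord F' c0 {c0 ! 1, c0 ! 3}"
          using 2 F in\<Omega> l by (auto simp: is_chord_def F'_def)
        then show ?thesis by blast
      qed
    next
      case False
      then obtain k where k: "k < length c0" "c0 ! k \<notin> \<Omega>" by (metis in_set_conv_nth subsetI)
      \<comment> \<open>The cycle is rotated to start outside \<Omega>, in the component of
        \<open>c ! 0\<close>.\<close>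
      define c where "c = rotate k c0"
      have ce: "cycle_edges c = cycle_edges c0" by (simp add: c_def cycle_edges_rotate)
      have sc: "set c = set c0" "length c = length c0" "distinct c"
        using c0 by (auto simp: c_def is_cycle_def)
      have "0 < length c0" using k by linarith
      then have "c ! 0 = c0 ! k" using k by (simp only: c_def nth_rotate add_0_right mod_less)
      then have a: "c ! 0 \<in> V - \<Omega>" using k c0 by (auto simp: is_cycle_def)
      let ?a = "c ! 0" and ?n = "length c"
      have n: "4 \<le> ?n" using c0 sc by simp
      have edge: "{c ! i, c ! (Suc i mod ?n)} \<in> F'" if "i < ?n" for i
      proof -
        have "{c ! i, c ! (Suc i mod ?n)} \<in> cycle_edges c"
          unfolding cycle_edges_def using that by auto
        then show ?thesis using c0 ce by (auto simp: is_cycle_def)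
      qed
      have "\<exists>e. is_chord F' c e"
      proof (cases "set c \<subseteq> ?C ?a \<union> ?B ?a")
        case True
        \<comment> \<open>Here any chord in \<open>F\<close> survives: it stays within one component
          and its boundary, and it is not \<open>{x, y}\<close> because that boundary does not
          contain both vertices.\<close>
        have "is_cycle V F c" using c0 sc ce F'F by (auto simp: is_cycle_def)
        then obtain e where e: "is_chord F c e" using ch n by (auto simp: chordal_def)
        then have "e \<subseteq> ?C ?a \<union> ?B ?a" using True by (auto simp: is_chord_def)
        moreover from this have "e \<noteq> {x, y}"
        proof -
          have "\<not> {x, y} \<subseteq> ?B ?a" using no a by blast
          moreover have "x \<notin> ?C ?a" "y \<notin> ?C ?a" using component_disjoint x y a by fastforce+
          ultimately show ?thesis using \<open>e \<subseteq> ?C ?a \<union> ?B ?a\<close> by auto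
        qed
        ultimately have "is_chord F' c e" using e a by (auto simp: is_chord_def F'_def)
        then show ?thesis by blast
      next
        case False
        then obtain j where j: "j < ?n" "c ! j \<notin> ?C ?a" "c ! j \<notin> ?B ?a"
          by (metis UnCI in_set_conv_nth subsetI)
        \<comment> \<open>The first and last positions outside the component, \<open>i1\<close> and
          \<open>i2\<close>, must be in its boundary, hence in the clique \<Omega>. Position
          \<open>j\<close> is in neither the component nor its boundary, so it lies strictly between
          them and they are not consecutive; \<open>i1 \<noteq> 0\<close> excludes the closing
          edge.\<close>
        define i1 where "i1 = (LEAST i. c ! i \<notin> ?C ?a)"
        have i1: "c ! i1 \<notin> ?C ?a" unfolding i1_def by (rule LeastI[of _ j]) (use j in simp)
        have "i1 \<le> j" unfolding i1_def by (rule Least_le) (use j in simp)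
        have "i1 \<noteq> 0" using i1 self_in_component by metis
        then obtain i where i: "i1 = Suc i" by (cases i1) auto
        then have "c ! i \<in> ?C ?a" using not_less_Least[of i "\<lambda>i. c ! i \<notin> ?C ?a"]
          by (auto simp: i1_def)
        moreover have "{c ! i, c ! i1} \<in> F'" using edge[of i] i \<open>i1 \<le> j\<close> j by simp
        ultimately have B1: "c ! i1 \<in> ?B ?a" using leave[OF _ _ a] i1 by blast
        then have "i1 < j" using \<open>i1 \<le> j\<close> j by (metis le_neq_implies_less)
        define i2 where "i2 = (GREATEST i. i < ?n \<and> c ! i \<notin> ?C ?a)"
        have i2: "i2 < ?n \<and> c ! i2 \<notin> ?C ?a"
          unfolding i2_def by (rule GreatestI_nat[of _ j ?n]) (use j in auto)
        have "j \<le> i2" unfolding i2_def by (rule Greatest_le_nat[of _ j ?n]) (use j in auto)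
        \<comment> \<open>If \<open>i2\<close> is the last position of the list, its successor wraps
          around to position 0, which is in the component.\<close>
        have next_in: "c ! (Suc i2 mod ?n) \<in> ?C ?a"
        proof (cases "Suc i2 = ?n")
          case False
          then have "Suc i2 < ?n" using i2 by simp
          then have "c ! Suc i2 \<in> ?C ?a"
            using Greatest_le_nat[of "\<lambda>i. i < ?n \<and> c ! i \<notin> ?C ?a" "Suc i2" ?n]
            by (auto simp flip: i2_def)
          then show ?thesis using \<open>Suc i2 < ?n\<close> by simp
        qed simp
        have "{c ! (Suc i2 mod ?n), c ! i2} \<in> F'"
          using edge[of i2] i2 by (simp add: insert_commute)
        then have B2: "c ! i2 \<in> ?B ?a" using leave[OF _ next_in a] i2 by blast
        then have "j < i2" using \<open>j \<le> i2\<close> j by (metis le_neq_implies_less)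
        have ne: "c ! i1 \<noteq> c ! i2"
          using sc i2 \<open>i1 < j\<close> \<open>j < i2\<close> by (simp add: nth_eq_iff_index_eq)
        have in\<Omega>: "c ! i1 \<in> \<Omega>" "c ! i2 \<in> \<Omega>" using B1 B2 by (auto simp: boundary_def)
        then have "{c ! i1, c ! i2} \<in> F" using \<Omega> ne by (auto simp: clique_def)
        moreover have "{c ! i1, c ! i2} \<noteq> {x, y}"
        proof
          assume "{c ! i1, c ! i2} = {x, y}"
          moreover have "{c ! i1, c ! i2} \<subseteq> ?B ?a" using B1 B2 by simp
          ultimately show False using no a by auto
        qed
        ultimately have "{c ! i1, c ! i2} \<in> F'" using in\<Omega> by (auto simp: F'_def)
        moreover have "{c ! i1, c ! i2} \<notin> cycle_edges c"
          using sc i2 \<open>i1 < j\<close> \<open>j < i2\<close> \<open>i1 \<noteq> 0\<close> by (intro not_cycle_edge) auto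
        ultimately have "is_chord F' c {c ! i1, c ! i2}"
          using i2 \<open>i1 < j\<close> \<open>j < i2\<close> by (auto simp: is_chord_def)
        then show ?thesis by blast
      qed
      then show ?thesis using ce sc by (auto simp: is_chord_def)
    qed
  qed
  then have "triangulation V E F'" using EF' by (simp add: triangulation_def)
  then show False using T strict by (auto simp: minimal_triangulation_def)
qed

section \<open>Counting\<close>

text \<open>Colour an element of a minimum member \<open>e\<close> with 1, the rest of \<open>e\<close> with 2 and everything
  else with 3.\<close>

lemma intersecting_family_3_colourable:
  fixes \<F> :: "'b set set"
  assumes fin: "\<And>f. f \<in> \<F> \<Longrightarrow> finite f"
    and int: "\<And>f g. f \<in> \<F> \<Longrightarrow> g \<in> \<F> \<Longrightarrow> f \<inter> g \<noteq> {}"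
    and big: "\<And>f. f \<in> \<F> \<Longrightarrow> \<exists>s\<in>f. \<exists>t\<in>f. s \<noteq> t"
  shows "\<exists>col :: 'b \<Rightarrow> nat. range col \<subseteq> {1,2,3} \<and> (\<forall>f\<in>\<F>. \<exists>s\<in>f. \<exists>t\<in>f. col s \<noteq> col t)"
proof (cases "\<F> = {}")
  case True
  then show ?thesis by (intro exI[of _ "\<lambda>_. 1"]) auto
next
  case False
  then obtain e where e: "e \<in> \<F>" and min: "\<And>f. f \<in> \<F> \<Longrightarrow> card e \<le> card f"
    using ex_has_least_nat[of "\<lambda>f. f \<in> \<F>" _ card] by blast
  obtain v where v: "v \<in> e" using big[OF e] by blast
  define col :: "'b \<Rightarrow> nat" where "col = (\<lambda>z. if z = v then 1 else if z \<in> e then 2 else 3)"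
  have "\<exists>s\<in>f. \<exists>t\<in>f. col s \<noteq> col t" if f: "f \<in> \<F>" for f
  proof (rule ccontr)
    assume "\<not> ?thesis"
    then have mono: "\<And>s t. s \<in> f \<Longrightarrow> t \<in> f \<Longrightarrow> col s = col t" by blast
    obtain z where z: "z \<in> f" "z \<in> e" using int[OF f e] by blast
    show False
    proof (cases "z = v")
      case True
      then have "col s = 1" if "s \<in> f" for s using mono[OF that z(1)] by (simp add: col_def)
      moreover have "s = v" if "col s = 1" for s using that by (simp add: col_def split: if_splits)
      ultimately have "\<And>s. s \<in> f \<Longrightarrow> s = v" by blast
      then show False using big[OF f] by blast
    next
      case False
      then have "col s = 2" if "s \<in> f" for s using mono[OF that z(1)] z by (simp add: col_def)
      moreover have "s \<in> e - {v}" if "col s = 2" for s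
        using that by (simp add: col_def split: if_splits)
      ultimately have "\<And>s. s \<in> f \<Longrightarrow> s \<in> e - {v}" by blast
      then have "f \<subset> e" using v by blast
      then have "card f < card e" by (rule psubset_card_mono[OF fin[OF e]])
      then show False using min[OF f] by simp
    qed
  qed
  then show ?thesis by (intro exI[of _ col]) (auto simp: col_def)
qed

text \<open>Swapping the colours 1 and \<open>col v\<close> is injective, so no set becomes
  monochromatic. Fixing one colour halves the number of codes needed later.\<close>

lemma intersecting_family_3_colourable_normalised:
  fixes \<F> :: "'b set set"
  assumes "\<And>f. f \<in> \<F> \<Longrightarrow> finite f"
    and "\<And>f g. f \<in> \<F> \<Longrightarrow> g \<in> \<F> \<Longrightarrow> f \<inter> g \<noteq> {}"
    and "\<And>f. f \<in> \<F> \<Longrightarrow> \<exists>s\<in>f. \<exists>t\<in>f. s \<noteq> t"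
  shows "\<exists>col :: 'b \<Rightarrow> nat. range col \<subseteq> {1,2,3} \<and> col v = 1 \<and>
    (\<forall>f\<in>\<F>. \<exists>s\<in>f. \<exists>t\<in>f. col s \<noteq> col t)"
proof -
  obtain col :: "'b \<Rightarrow> nat" where col: "range col \<subseteq> {1,2,3}"
    "\<forall>f\<in>\<F>. \<exists>s\<in>f. \<exists>t\<in>f. col s \<noteq> col t"
    using intersecting_family_3_colourable[of \<F>] assms by blast
  define \<pi> where "\<pi> = (\<lambda>m. if m = col v then 1 else if m = 1 then col v else m)"
  have inj: "\<pi> m = \<pi> m' \<longleftrightarrow> m = m'" for m m' by (auto simp: \<pi>_def)
  have col123: "col s \<in> {1,2,3}" for s using col(1) by blast
  have "\<pi> (col s) \<in> {1,2,3}" for s using col123[of s] col123[of v] by (auto simp: \<pi>_def)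
  moreover have "\<pi> (col v) = 1" by (simp add: \<pi>_def)
  ultimately show ?thesis using col(2) by (intro exI[of _ "\<lambda>s. \<pi> (col s)"]) (auto simp: inj)
qed

text \<open>Passing from \<open>k\<close> to \<open>k + 1\<close> multiplies the left side by 3(k +
  1)/k, which is at most 4 once \<open>k \<ge> 3\<close>. The induction therefore starts at 3, where
  the claim reads 27 \<le> 32.\<close>

lemma mult_three_pow_le: "k * 3 ^ (k - 1) \<le> 2 * 4 ^ (k - 1)" for k :: nat
proof -
  have big: "(m + 3) * 3 ^ (m + 2) \<le> 2 * 4 ^ (m + 2)" for m :: nat
  proof (induction m)
    case (Suc m)
    have "(Suc m + 3) * 3 ^ (Suc m + 2) = (3 * (m + 4)) * 3 ^ (m + 2)"
      by (simp add: algebra_simps)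
    also have "\<dots> \<le> (4 * (m + 3)) * 3 ^ (m + 2)"
      by (intro mult_right_mono) auto
    also have "\<dots> = 4 * ((m + 3) * 3 ^ (m + 2))" by (simp only: mult.assoc)
    also have "\<dots> \<le> 4 * (2 * 4 ^ (m + 2))" using Suc by (intro mult_left_mono) auto
    finally show ?case by simp
  qed simp
  consider "k = 0" | "k = 1" | "k = 2" | m where "k = m + 3"
    by (metis One_nat_def Suc_1 add.commute add_Suc_right add_0 not0_implies_Suc numeral_3_eq_3)
  then show ?thesis
  proof cases
    case 4
    then show ?thesis using big[of m] by simp
  qed auto
qed

section \<open>Encoding potential maximal cliques by data on the vertex cover\<close>

definition closed_nbhd :: "'a set set \<Rightarrow> 'a \<Rightarrow> 'a set" where
  "closed_nbhd E x = insert x {y. {x, y} \<in> E}"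

text \<open>Colour 0 marks \<open>S \<inter> \<Omega>\<close>.\<close>

definition decode_colouring :: "'a set \<Rightarrow> 'a set set \<Rightarrow> 'a set \<Rightarrow> ('a \<Rightarrow> nat) \<Rightarrow> 'a set" where
  "decode_colouring V E S \<sigma> = {s \<in> S. \<sigma> s = 0} \<union>
     {x \<in> V - S. \<exists>s\<in>S. \<exists>t\<in>S. {x, s} \<in> E \<and> {x, t} \<in> E \<and> \<sigma> s \<noteq> 0 \<and> \<sigma> t \<noteq> 0 \<and> \<sigma> s \<noteq> \<sigma> t}"

text \<open>Colour 0 marks \<open>S \<inter> \<Omega> - {y}\<close>, colour 1 a distinguished component \<open>C\<close>, and colour 2 the
  other components; \<open>y\<close> is a vertex of \<open>\<Omega>\<close> without neighbours in \<open>C\<close>.\<close>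

definition decode_pointed :: "'a set \<Rightarrow> 'a set set \<Rightarrow> 'a set \<Rightarrow> 'a \<times> ('a \<Rightarrow> nat) \<Rightarrow> 'a set" where
  "decode_pointed V E S = (\<lambda>(y, \<sigma>). insert y ({s \<in> S - {y}. \<sigma> s = 0} \<union>
     {x \<in> V - S. (\<exists>s\<in>S - {y}. {x, s} \<in> E \<and> \<sigma> s = 1) \<and>
        ({x, y} \<in> E \<or> (\<exists>t\<in>S - {y}. {x, t} \<in> E \<and> \<sigma> t = 2))}))"

text \<open>For \<open>x\<close> outside the cover \<open>S\<close> every neighbour is in
  \<open>S\<close>, so these are all components of G - \<Omega> in which \<open>x\<close> has a
  neighbour.\<close>

definition seen_components :: "'a set set \<Rightarrow> 'a set \<Rightarrow> 'a set \<Rightarrow> 'a \<Rightarrow> 'a set set" where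
  "seen_components E S \<Omega> x = component E \<Omega> ` {s \<in> S - \<Omega>. {x, s} \<in> E}"

text \<open>A code describes only \<open>S\<close>, so vertices outside \<open>S\<close> must be
  recognised from their neighbours. A vertex outside both \<open>S\<close> and \<Omega> has its
  neighbours outside \<Omega> in a single component, its own; this lets the decoders reject
  it.\<close>

lemma pmc_encoding:
  assumes G: "finite_simple_graph V E" and S: "vertex_cover V E S"
    and P: "potential_maximal_clique V E \<Omega>"
  shows "\<Omega> \<in> closed_nbhd E ` V
    \<or> \<Omega> \<in> decode_colouring V E S ` (PiE S (\<lambda>s. if s = s0 then {0,1} else {0,1,2,3}))
    \<or> \<Omega> \<in> decode_pointed V E S ` (SIGMA y:S. PiE (S - {y}) (\<lambda>_. {0,1,2}))"
proof -
  obtain F where T: "minimal_triangulation V E F" and M: "maximal_clique V F \<Omega>"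
    using P by (auto simp: potential_maximal_clique_def)
  have \<Omega>V: "\<Omega> \<subseteq> V" using M by (simp add: maximal_clique_def)
  have SV: "S \<subseteq> V" using S by (simp add: vertex_cover_def)
  have finS: "finite S" using SV G by (auto simp: finite_simple_graph_def intro: finite_subset)
  let ?C = "component E \<Omega>"
  let ?B = "\<lambda>a. boundary E \<Omega> (?C a)"
  let ?N = "seen_components E S \<Omega>"
  have not_full: "\<exists>w\<in>\<Omega>. w \<notin> ?B a" if "a \<in> V - \<Omega>" for a
    using component_not_full[OF G _ M that] T by (simp add: minimal_triangulation_def)
  have share: "\<exists>a\<in>V - \<Omega>. x \<in> ?B a \<and> y \<in> ?B a"
    if "x \<in> \<Omega>" "y \<in> \<Omega>" "x \<noteq> y" "{x, y} \<notin> E" for x y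
    using nonadjacent_share_component[OF G T M that] by simp
  have cover: "y \<in> S" if "{x, y} \<in> E" "x \<notin> S" for x y
    using S that by (auto simp: vertex_cover_def)
  have seen: "?C a \<in> ?N x" if "x \<in> V - S" "a \<in> V - \<Omega>" "x \<in> ?B a" for x a
  proof -
    obtain c where c: "c \<in> ?C a" "{x, c} \<in> E"
      using boundaryE[OF \<open>x \<in> ?B a\<close>] by blast
    have "c \<notin> \<Omega>" using component_disjoint c that by fastforce
    then have "?C c \<in> ?N x" using c cover that by (auto simp: seen_components_def)
    then show ?thesis using component_eq c by metis
  qed
  have outside: "?C s = ?C x" if "x \<in> V - S" "x \<notin> \<Omega>" "{x, s} \<in> E" "s \<notin> \<Omega>" for x s
    using that component_adjacent by metis
  \<comment> \<open>Two vertices outside a vertex cover are nonadjacent, so the shared component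
    exists.\<close>
  have common: "?N x \<inter> ?N x' \<noteq> {}" if x: "x \<in> \<Omega> - S" "x' \<in> \<Omega> - S" "x \<noteq> x'" for x x'
  proof -
    have "{x, x'} \<notin> E" using cover x by blast
    then obtain a where "a \<in> V - \<Omega>" "x \<in> ?B a" "x' \<in> ?B a" using share[of x x'] x by blast
    then show ?thesis using seen[of x a] seen[of x' a] x \<Omega>V by blast
  qed
  have isolated: "\<Omega> = closed_nbhd E x" if x: "x \<in> \<Omega> - S" and N: "?N x = {}" for x
  proof
    have none: "y \<in> \<Omega>" if "{x, y} \<in> E" for y
      using that x N cover by (auto simp: seen_components_def)
    show "\<Omega> \<subseteq> closed_nbhd E x"
    proof
      fix y assume y: "y \<in> \<Omega>"
      show "y \<in> closed_nbhd E x"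
      proof (rule ccontr)
        assume "y \<notin> closed_nbhd E x"
        then obtain a where "a \<in> V - \<Omega>" "x \<in> ?B a"
          using share[of x y] x y by (auto simp: closed_nbhd_def)
        then show False using seen[of x a] x N \<Omega>V by blast
      qed
    qed
    show "closed_nbhd E x \<subseteq> \<Omega>" using none x by (auto simp: closed_nbhd_def)
  qed
  show ?thesis
  proof (cases "\<Omega> \<in> closed_nbhd E ` V")
    case False
    then have nonempty: "?N x \<noteq> {}" if "x \<in> \<Omega> - S" for x
      using isolated[OF that] that \<Omega>V by blast
    show ?thesis
    proof (cases "\<forall>x\<in>\<Omega> - S. \<exists>c\<in>?N x. \<exists>d\<in>?N x. c \<noteq> d")
      case True
      \<comment> \<open>The components are coloured, normalised at that of \<open>s0\<close>. Hence
        \<open>s0\<close> gets code 0 if it lies in \<Omega> and code 1 otherwise, which explains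
        its smaller range \<open>{0,1}\<close>.\<close>
      have "\<exists>col :: 'a set \<Rightarrow> nat. range col \<subseteq> {1,2,3} \<and> col (?C s0) = 1 \<and>
          (\<forall>f\<in>?N ` (\<Omega> - S). \<exists>s\<in>f. \<exists>t\<in>f. col s \<noteq> col t)"
      proof (rule intersecting_family_3_colourable_normalised)
        show "finite f" if "f \<in> ?N ` (\<Omega> - S)" for f
          using that finS by (auto simp: seen_components_def)
        show "f \<inter> g \<noteq> {}" if "f \<in> ?N ` (\<Omega> - S)" "g \<in> ?N ` (\<Omega> - S)" for f g
          using that common nonempty by fastforce
        show "\<exists>s\<in>f. \<exists>t\<in>f. s \<noteq> t" if "f \<in> ?N ` (\<Omega> - S)" for f
          using that True by auto
      qed
      then obtain col :: "'a set \<Rightarrow> nat" where col: "range col \<subseteq> {1,2,3}" "col (?C s0) = 1"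
        "\<forall>f\<in>?N ` (\<Omega> - S). \<exists>s\<in>f. \<exists>t\<in>f. col s \<noteq> col t" by (elim exE conjE)
      have two: "\<exists>s\<in>?N x. \<exists>t\<in>?N x. col s \<noteq> col t" if "x \<in> \<Omega> - S" for x
        using bspec[OF col(3) imageI[OF that]] .
      define \<sigma> where "\<sigma> = restrict (\<lambda>s. if s \<in> \<Omega> then 0 else col (?C s)) S"
      have col123: "col c \<in> {1,2,3}" for c using col(1) by blast
      have col0: "col c \<noteq> 0" for c using col123[of c] by auto
      have \<sigma>0: "\<sigma> s = 0 \<longleftrightarrow> s \<in> \<Omega>" if "s \<in> S" for s
        using that col0 by (simp add: \<sigma>_def)
      have \<sigma>1: "\<sigma> s = col (?C s)" if "s \<in> S" "s \<notin> \<Omega>" for s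
        using that by (simp add: \<sigma>_def)
      have "\<sigma> \<in> PiE S (\<lambda>s. if s = s0 then {0,1} else {0,1,2,3})"
        using col(2) col123 by (auto simp: \<sigma>_def)
      moreover have "\<Omega> = decode_colouring V E S \<sigma>"
      proof (rule set_eqI)
        fix x
        show "x \<in> \<Omega> \<longleftrightarrow> x \<in> decode_colouring V E S \<sigma>"
        proof (cases "x \<in> V - S")
          case False
          then show ?thesis using \<sigma>0[of x] \<Omega>V by (auto simp: decode_colouring_def)
        next
          case xI: True
          show ?thesis
          proof
            assume "x \<in> \<Omega>"
            then obtain s t where "s \<in> S - \<Omega>" "{x, s} \<in> E" "t \<in> S - \<Omega>" "{x, t} \<in> E"
              "col (?C s) \<noteq> col (?C t)"
              using two[of x] xI by (auto simp: seen_components_def)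
            then show "x \<in> decode_colouring V E S \<sigma>"
              using xI \<sigma>0 \<sigma>1 unfolding decode_colouring_def by fastforce
          next
            assume "x \<in> decode_colouring V E S \<sigma>"
            then obtain s t where st: "s \<in> S" "{x, s} \<in> E" "t \<in> S" "{x, t} \<in> E"
              "\<sigma> s \<noteq> 0" "\<sigma> t \<noteq> 0" "\<sigma> s \<noteq> \<sigma> t"
              using xI by (auto simp: decode_colouring_def)
            show "x \<in> \<Omega>"
            \<comment> \<open>Outside \<Omega>, the two differently coloured neighbours would lie in
              the same component.\<close>
            proof (rule ccontr)
              assume "x \<notin> \<Omega>"
              then have "?C s = ?C t" using outside xI st \<sigma>0 by metis
              then show False using st \<sigma>0 \<sigma>1 by metis
            qed
          qed
        qed
      qed
      ultimately show ?thesis by blast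
    next
      case False
      then obtain x0 where x0: "x0 \<in> \<Omega> - S" "\<And>c d. c \<in> ?N x0 \<Longrightarrow> d \<in> ?N x0 \<Longrightarrow> c = d" by blast
      obtain s1 where s1: "s1 \<in> S - \<Omega>" "{x0, s1} \<in> E"
        using nonempty[OF x0(1)] by (auto simp: seen_components_def)
      then have "?C s1 \<in> ?N x0" by (auto simp: seen_components_def)
      then have Nx0: "?N x0 = {?C s1}" using x0 by blast
      have s1V: "s1 \<in> V - \<Omega>" using s1 SV by blast
      obtain y where y: "y \<in> \<Omega>" "y \<notin> ?B s1" using not_full[OF s1V] by blast
      \<comment> \<open>Every \<open>x\<close> shares a seen component with \<open>x0\<close>, and
        \<open>x0\<close> sees only that of \<open>s1\<close>.\<close>
      have star: "?C s1 \<in> ?N x" if "x \<in> \<Omega> - S" for x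
        using common[OF that x0(1)] Nx0 by (cases "x = x0") auto
      have in_bd: "x \<in> ?B s1" if x: "x \<in> \<Omega> - S" for x
      proof -
        obtain s where s: "s \<in> S - \<Omega>" "{x, s} \<in> E" "?C s1 = ?C s"
          using star[OF x] by (auto simp: seen_components_def)
        have "s \<in> ?C s1" using s by simp
        then show ?thesis using s x by (auto simp: boundary_def insert_commute)
      qed
      \<comment> \<open>If nonadjacent, \<open>x\<close> and \<open>y\<close> would both border a
        common component. It could only be that of \<open>s1\<close>, whose boundary misses
        \<open>y\<close>.\<close>
      have y_adj: "{x, y} \<in> E" if x: "x \<in> \<Omega> - S" and N: "?N x = {?C s1}" for x
      proof (rule ccontr)
        assume "{x, y} \<notin> E"
        moreover have "x \<noteq> y" using in_bd[OF x] y by auto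
        ultimately obtain a where a: "a \<in> V - \<Omega>" "x \<in> ?B a" "y \<in> ?B a"
          using share[of x y] x y by blast
        then have "?C a = ?C s1" using seen[of x a] x N \<Omega>V by blast
        then show False using a y by simp
      qed
      have yS: "y \<in> S" using y_adj[OF x0(1) Nx0] cover x0 by blast
      define \<sigma> :: "'a \<Rightarrow> nat" where
        "\<sigma> = restrict (\<lambda>s. if s \<in> \<Omega> then 0 else if s \<in> ?C s1 then 1 else 2) (S - {y})"
      have \<sigma>: "\<sigma> s = 0 \<longleftrightarrow> s \<in> \<Omega>" "\<sigma> s = 1 \<longleftrightarrow> s \<notin> \<Omega> \<and> s \<in> ?C s1"
        "\<sigma> s = 2 \<longleftrightarrow> s \<notin> \<Omega> \<and> s \<notin> ?C s1" if "s \<in> S - {y}" for s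
        using that by (auto simp: \<sigma>_def)
      have "\<sigma> \<in> PiE (S - {y}) (\<lambda>_. {0,1,2})" by (auto simp: \<sigma>_def)
      then have "(y, \<sigma>) \<in> (SIGMA y:S. PiE (S - {y}) (\<lambda>_. {0,1,2}))" using yS by blast
      moreover have "\<Omega> = decode_pointed V E S (y, \<sigma>)"
      proof (rule set_eqI)
        fix x
        show "x \<in> \<Omega> \<longleftrightarrow> x \<in> decode_pointed V E S (y, \<sigma>)"
        proof (cases "x \<in> V - S")
          case False
          then show ?thesis using \<sigma>(1)[of x] \<Omega>V y by (auto simp: decode_pointed_def)
        next
          case xI: True
          have "x \<noteq> y" using xI yS by auto
          show ?thesis
          proof
            assume x: "x \<in> \<Omega>"
            then have x': "x \<in> \<Omega> - S" using xI by simp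
            obtain s where s: "s \<in> S - \<Omega>" "{x, s} \<in> E" "?C s1 = ?C s"
              using star[OF x'] by (auto simp: seen_components_def)
            have "s \<in> S - {y}" "\<sigma> s = 1" using s y \<sigma>(2)[of s] by auto
            moreover have "{x, y} \<in> E \<or> (\<exists>t\<in>S - {y}. {x, t} \<in> E \<and> \<sigma> t = 2)"
            proof (cases "?N x = {?C s1}")
              case True
              then show ?thesis using y_adj[OF x'] by simp
            next
              case False
              then obtain t where t: "t \<in> S - \<Omega>" "{x, t} \<in> E" "?C t \<noteq> ?C s1"
                using star[OF x'] by (auto simp: seen_components_def)
              then have "t \<notin> ?C s1" using component_eq by metis
              then show ?thesis using t y \<sigma>(3)[of t] by auto
            qed
            ultimately show "x \<in> decode_pointed V E S (y, \<sigma>)"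
              using xI s by (auto simp: decode_pointed_def)
          next
            assume "x \<in> decode_pointed V E S (y, \<sigma>)"
            then obtain s where s: "s \<in> S - {y}" "{x, s} \<in> E" "\<sigma> s = 1"
              and or: "{x, y} \<in> E \<or> (\<exists>t\<in>S - {y}. {x, t} \<in> E \<and> \<sigma> t = 2)"
              using xI \<open>x \<noteq> y\<close> by (auto simp: decode_pointed_def)
            have s': "s \<notin> \<Omega>" "s \<in> ?C s1" using \<sigma>(2)[OF s(1)] s by auto
            show "x \<in> \<Omega>"
            proof (rule ccontr)
              assume x: "x \<notin> \<Omega>"
              \<comment> \<open>The neighbour \<open>s\<close> of colour 1 forces \<open>x\<close>
                into the component of \<open>s1\<close>. From there it can reach neither
                \<open>y\<close>, which is not in the boundary, nor a vertex \<open>t\<close> of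
                another component.\<close>
              have Cx: "?C x = ?C s1" using outside[OF xI x s(2) s'(1)] component_eq[OF s'(2)] by simp
              then have xC: "x \<in> ?C s1" by (metis self_in_component)
              from or show False
              proof
                assume "{x, y} \<in> E"
                then show False using xC y by (auto simp: boundary_def)
              next
                assume "\<exists>t\<in>S - {y}. {x, t} \<in> E \<and> \<sigma> t = 2"
                then obtain t where t: "{x, t} \<in> E" "t \<notin> \<Omega>" "t \<notin> ?C s1"
                  using \<sigma>(3) by blast
                then show False using outside[OF xI x t(1,2)] Cx by (metis self_in_component)
              qed
            qed
          qed
        qed
      qed
      ultimately show ?thesis by blast
    qed
  qed simp
qed

section \<open>Sizes of the code sets and the final bound\<close>

lemma card_normalised_colourings:
  assumes "finite S" "s0 \<in> S"
  shows "card (PiE S (\<lambda>s. if s = s0 then {0,1::nat} else {0,1,2,3})) = 2 * 4 ^ (card S - 1)"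
proof -
  have "card (PiE S (\<lambda>s. if s = s0 then {0,1::nat} else {0,1,2,3})) =
      (\<Prod>s\<in>S. if s = s0 then 2 else 4)"
    using assms by (subst card_PiE) (auto intro!: prod.cong)
  also have "\<dots> = 2 * (\<Prod>s\<in>S - {s0}. if s = s0 then 2 else 4)"
    using assms by (subst prod.remove[of _ s0]) auto
  also have "(\<Prod>s\<in>S - {s0}. if s = s0 then 2 else 4) = (\<Prod>s\<in>S - {s0}. 4::nat)"
    by (intro prod.cong) auto
  finally show ?thesis using assms by simp
qed

theorem theorem9:
  fixes V :: "'a set" and E :: "'a set set" and S :: "'a set" and n k :: nat
  assumes "finite_simple_graph V E"
    and "card V = n"
    and "vertex_cover V E S"
    and "card S = k"
  shows "card {\<Omega>. potential_maximal_clique V E \<Omega>} \<le> 4 ^ k + n"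
proof -
  have finV: "finite V" using assms by (simp add: finite_simple_graph_def)
  then have finS: "finite S" using assms by (auto simp: vertex_cover_def intro: finite_subset)
  obtain s0 where s0: "S \<noteq> {} \<Longrightarrow> s0 \<in> S" by blast
  define A where "A = PiE S (\<lambda>s. if s = s0 then {0,1::nat} else {0,1,2,3})"
  define B where "B = (SIGMA y:S. PiE (S - {y}) (\<lambda>_. {0,1,2::nat}))"
  have finA: "finite A" using finS by (auto simp: A_def intro!: finite_PiE)
  have finB: "finite B" using finS by (auto simp: B_def intro!: finite_PiE)
  have "card B = (\<Sum>y\<in>S. card (PiE (S - {y}) (\<lambda>_. {0,1,2::nat})))"
    unfolding B_def using finS by (intro card_SigmaI) (auto intro!: finite_PiE)
  also have "\<dots> = (\<Sum>y\<in>S. 3 ^ (k - 1))"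
    using finS assms by (intro sum.cong) (auto simp: card_PiE numeral_3_eq_3)
  finally have cB: "card B = k * 3 ^ (k - 1)" using assms by simp
  have AB: "card A + card B \<le> 4 ^ k"
  proof (cases "S = {}")
    \<comment> \<open>With an empty cover, \<open>A\<close> holds just the empty function and
      \<open>B\<close> is empty, matching \<open>4 ^ 0 = 1\<close>.\<close>
    case True
    then show ?thesis using cB assms by (simp add: A_def)
  next
    case False
    then have "k \<noteq> 0" using finS assms by auto
    have "card A = 2 * 4 ^ (k - 1)"
      using card_normalised_colourings[OF finS s0[OF False]] assms by (simp add: A_def)
    \<comment> \<open>Each of \<open>A\<close> and \<open>B\<close> has at most
      \<open>2 * 4 ^ (k - 1)\<close> elements, half of \<open>4 ^ k\<close>.\<close>
    then have "card A + card B \<le> 4 * 4 ^ (k - 1)" using mult_three_pow_le[of k] cB by simp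
    also have "\<dots> = 4 ^ k" using \<open>k \<noteq> 0\<close> by (cases k) auto
    finally show ?thesis .
  qed
  let ?U = "closed_nbhd E ` V \<union> (decode_colouring V E S ` A \<union> decode_pointed V E S ` B)"
  have "{\<Omega>. potential_maximal_clique V E \<Omega>} \<subseteq> ?U"
    using pmc_encoding[OF assms(1,3), of _ s0] unfolding A_def B_def by blast
  then have "card {\<Omega>. potential_maximal_clique V E \<Omega>} \<le> card ?U"
    using finV finA finB by (intro card_mono) auto
  also have "\<dots> \<le> card (closed_nbhd E ` V) +
      (card (decode_colouring V E S ` A) + card (decode_pointed V E S ` B))"
    by (meson add_left_mono card_Un_le le_trans)
  also have "\<dots> \<le> n + (card A + card B)"
    using assms(2) finV finA finB by (intro add_mono) (auto intro: card_image_le)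
  also have "\<dots> \<le> 4 ^ k + n" using AB by simp
  finally show ?thesis .
qed

end
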